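(* Let $X$ be an ambitable semiuniform semigroup, let $S\subseteq\mathbf{M}(X)$, and suppose that $S$ with the operation $\star$ is a semigroup such that $\overline{X}\subseteq S$. Then $\Lambda(S)=\mathbf{M_u}(X)\cap S$, where $S$ carries the weak* topology.
   Context: All uniform spaces are Hausdorff, all linear spaces are over $\mathbb{R}$. A semigroup $X$ with a uniform structure is a semiuniform semigroup if (a) the set of maps $\{x\mapsto xy : y\in X\}$ from $X$ to $X$ is uniformly equicontinuous, and (b) for each $x\in X$ the map $y\mapsto xy$ from $X$ to $X$ is uniformly continuous. $\mathbf{U_b}(X)$ is the space of bounded uniformly continuous real-valued functions on $X$ with the sup norm; $\mathbf{M}(X)$ is its norm dual; the weak* topology on $\mathbf{M}(X)$ is the weak topology of the duality $\langle\mathbf{M}(X),\mathbf{U_b}(X)\rangle$. For a uniformly continuous pseudometric $\Delta$ on $X$, $\mathrm{Lip}(\Delta)$ is the set of $f:X\to[-1,1]$ with $|f(x)-f(x')|\le\Delta(x,x')$ for all $x,x'$, and $\mathrm{Lip}^+(\Delta)=\{f\in\mathrm{Lip}(\Delta): f\ge0\}$, both with the topology of pointwise convergence on $X$. $\mathbf{M_u}(X)$ is the set of $\mu\in\mathbf{M}(X)$ that are continuous on $\mathrm{Lip}(\Delta)$ for every uniformly continuous pseudometric $\Delta$ on $X$ (equivalently, continuous on $\mathrm{Lip}^+(\Delta)$ for every such $\Delta$). For $x\in X$, $\delta_x\in\mathbf{M}(X)$ is $\delta_x(f)=f(x)$; $\overline{X}$ is the weak* closure of $\{\delta_x:x\in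 X\}$ in $\mathbf{M}(X)$. Convolution on $\mathbf{M}(X)$: $(\mu\star\nu)(f)=\mu\big(x\mapsto\nu(y\mapsto f(xy))\big)$ for $f\in\mathbf{U_b}(X)$. For $f:X\to\mathbb{R}$ and $x\in X$, the right translation is $\rho^x(f): z\mapsto f(zx)$; $\mathrm{orb}(f)=\{\rho^x(f):x\in X\}$; $\overline{\mathrm{orb}(f)}$ is its closure in the product space $\mathbb{R}^X$. A semiuniform semigroup $X$ is ambitable if for every uniformly continuous pseudometric $\Delta$ on $X$ there exists $f\in\mathbf{U_b}(X)$ such that $\mathrm{Lip}^+(\Delta)\subseteq\overline{\mathrm{orb}(f)}$. For a semigroup $S$ with a topology, $\Lambda(S)=\{x\in S : \text{the map } y\mapsto xy \text{ is continuous on } S\}$. The semigroup operation on subsets of $\mathbf{M}(X)$ is $\star$. *)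

theory Defs
  imports "HOL-Analysis.Analysis"
begin

section \<open>Semiuniform semigroups\<close>

text \<open>The uniformities are explicit arguments so that the notion can be used in a class assumption.\<close>

definition uniformly_equicontinuous ::
    "('a \<times> 'a) filter \<Rightarrow> ('b \<times> 'b) filter \<Rightarrow> ('a \<Rightarrow> 'b) set \<Rightarrow> bool" where
  "uniformly_equicontinuous U V F \<longleftrightarrow>
    (\<forall>E. eventually E V \<longrightarrow> (\<forall>\<^sub>F (x, x') in U. \<forall>f\<in>F. E (f x, f x')))"

class semiuniform_semigroup = uniform_space + t2_space + semigroup_mult +
  assumes uniformly_equicontinuous_mult_right:
      "uniformly_equicontinuous uniformity uniformity (range (\<lambda>y x. x * y))"
    and filterlim_uniformity_mult_left:
      "filterlim (\<lambda>(y, y'). (x * y, x * y')) uniformity uniformity"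

lemma uniformly_continuous_mult_left:
  "uniformly_continuous_on UNIV (\<lambda>y. x * y)" for x :: "'a::semiuniform_semigroup"
  using filterlim_uniformity_mult_left[of x] by (simp add: uniformly_continuous_on_uniformity)

section \<open>Bounded uniformly continuous functions\<close>

lemma uniformly_continuous_on_UNIV_metric:
  fixes f :: "'a::uniform_space \<Rightarrow> 'b::metric_space"
  shows "uniformly_continuous_on UNIV f \<longleftrightarrow>
    (\<forall>e>0. \<forall>\<^sub>F (x, x') in uniformity. dist (f x) (f x') < e)"
proof -
  have "uniformly_continuous_on UNIV f \<longleftrightarrow>
      (\<forall>E. eventually E uniformity \<longrightarrow> (\<forall>\<^sub>F z in uniformity. E (f (fst z), f (snd z))))"
    by (simp add: uniformly_continuous_on_uniformity filterlim_iff case_prod_unfold)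
  also have "\<dots> \<longleftrightarrow> (\<forall>e>0. \<forall>\<^sub>F z in uniformity. dist (f (fst z)) (f (snd z)) < e)"
  proof (intro iffI allI impI)
    fix e :: real
    assume *: "\<forall>E. eventually E uniformity \<longrightarrow> (\<forall>\<^sub>F z in uniformity. E (f (fst z), f (snd z)))"
      and "e > 0"
    have "\<forall>\<^sub>F (x, y) in uniformity. dist (x::'b) y < e"
      using \<open>e > 0\<close> by (auto simp: eventually_uniformity_metric)
    from *[rule_format, OF this] show "\<forall>\<^sub>F z in uniformity. dist (f (fst z)) (f (snd z)) < e"
      by simp
  next
    fix E :: "'b \<times> 'b \<Rightarrow> bool"
    assume *: "\<forall>e>0. \<forall>\<^sub>F z in uniformity. dist (f (fst z)) (f (snd z)) < e"
      and "eventually E uniformity"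
    then obtain e where "e > 0" and e: "\<And>x y. dist x y < e \<Longrightarrow> E (x, y)"
      by (auto simp: eventually_uniformity_metric)
    from *[rule_format, OF \<open>e > 0\<close>] show "\<forall>\<^sub>F z in uniformity. E (f (fst z), f (snd z))"
      by eventually_elim (use e in auto)
  qed
  finally show ?thesis
    by (simp add: case_prod_unfold)
qed

typedef (overloaded) 'a ubfun =
  "{f :: 'a::uniform_space \<Rightarrow> real. uniformly_continuous_on UNIV f \<and> bounded (range f)}"
  morphisms apply_ubfun Ubfun
  by (rule exI[of _ "\<lambda>_. 0"]) (auto simp: uniformly_continuous_on_UNIV_metric case_prod_unfold)

setup_lifting type_definition_ubfun

lemma apply_ubfun_uniformly_continuous: "uniformly_continuous_on UNIV (apply_ubfun f)"
  and apply_ubfun_bounded: "bounded (range (apply_ubfun f))"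
  using apply_ubfun[of f] by auto

lemma ubfun_eqI: "(\<And>x. apply_ubfun f x = apply_ubfun g x) \<Longrightarrow> f = g"
  by (simp add: apply_ubfun_inject[symmetric] fun_eq_iff)

lemma ubfun_scaleR:
  fixes f :: "'a::uniform_space \<Rightarrow> real"
  assumes *: "uniformly_continuous_on UNIV f \<and> bounded (range f)"
  shows "uniformly_continuous_on UNIV (\<lambda>x. c * f x) \<and> bounded (range (\<lambda>x. c * f x))"
proof (intro conjI)
  show "uniformly_continuous_on UNIV (\<lambda>x. c * f x)"
    unfolding uniformly_continuous_on_UNIV_metric
  proof (intro allI impI)
    fix e :: real assume "e > 0"
    then have "e / (\<bar>c\<bar> + 1) > 0" by simp
    with * have "\<forall>\<^sub>F (x, y) in uniformity. dist (f x) (f y) < e / (\<bar>c\<bar> + 1)"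
      by (auto simp: uniformly_continuous_on_UNIV_metric)
    then show "\<forall>\<^sub>F (x, y) in uniformity. dist (c * f x) (c * f y) < e"
    proof eventually_elim
      case (elim z)
      obtain x y where z: "z = (x, y)" by force
      have "\<bar>c * f x - c * f y\<bar> = \<bar>c\<bar> * \<bar>f x - f y\<bar>"
        by (simp add: abs_mult[symmetric] right_diff_distrib)
      also have "\<dots> \<le> (\<bar>c\<bar> + 1) * \<bar>f x - f y\<bar>"
        by (simp add: mult_right_mono)
      also have "\<dots> < e"
        using elim by (simp add: z dist_real_def field_simps)
      finally show ?case by (simp add: z dist_real_def)
    qed
  qed
  show "bounded (range (\<lambda>x. c * f x))"
    using * bounded_scaleR_comp[of f UNIV c] by simp
qed

lemma ubfun_add:
  fixes f g :: "'a::uniform_space \<Rightarrow> real"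
  assumes *: "uniformly_continuous_on UNIV f \<and> bounded (range f)"
    "uniformly_continuous_on UNIV g \<and> bounded (range g)"
  shows "uniformly_continuous_on UNIV (\<lambda>x. f x + g x) \<and> bounded (range (\<lambda>x. f x + g x))"
proof (intro conjI)
  show "uniformly_continuous_on UNIV (\<lambda>x. f x + g x)"
    unfolding uniformly_continuous_on_UNIV_metric
  proof (intro allI impI)
    fix e :: real assume "e > 0"
    then have "e / 2 > 0" by simp
    with * have "\<forall>\<^sub>F (x, y) in uniformity. dist (f x) (f y) < e / 2"
        "\<forall>\<^sub>F (x, y) in uniformity. dist (g x) (g y) < e / 2"
      unfolding uniformly_continuous_on_UNIV_metric by blast+
    then show "\<forall>\<^sub>F (x, y) in uniformity. dist (f x + g x) (f y + g y) < e"
      proof eventually_elim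
      case (elim z)
      obtain x y where z: "z = (x, y)" by force
      show ?case
        using elim abs_triangle_ineq[of "f x - f y" "g x - g y"]
        by (simp add: z dist_real_def algebra_simps)
    qed
  qed
  show "bounded (range (\<lambda>x. f x + g x))"
    using * by (auto intro: bounded_plus_comp)
qed

instantiation ubfun :: (uniform_space) real_vector
begin

lift_definition zero_ubfun :: "'a ubfun" is "\<lambda>_. 0"
  by (auto simp: uniformly_continuous_on_UNIV_metric case_prod_unfold)

lift_definition plus_ubfun :: "'a ubfun \<Rightarrow> 'a ubfun \<Rightarrow> 'a ubfun" is "\<lambda>f g x. f x + g x"
  by (rule ubfun_add)

lift_definition scaleR_ubfun :: "real \<Rightarrow> 'a ubfun \<Rightarrow> 'a ubfun" is "\<lambda>c f x. c * f x"
  by (rule ubfun_scaleR)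

lift_definition uminus_ubfun :: "'a ubfun \<Rightarrow> 'a ubfun" is "\<lambda>f x. - f x"
  subgoal for f using ubfun_scaleR[of f "-1"] by simp
  done

lift_definition minus_ubfun :: "'a ubfun \<Rightarrow> 'a ubfun \<Rightarrow> 'a ubfun" is "\<lambda>f g x. f x - g x"
  subgoal for f g using ubfun_add[of f "\<lambda>x. -1 * g x"] ubfun_scaleR[of g "-1"] by simp
  done

instance
  by standard (transfer; simp add: fun_eq_iff algebra_simps)+

end

lemmas apply_ubfun_simps [simp] =
  zero_ubfun.rep_eq plus_ubfun.rep_eq scaleR_ubfun.rep_eq uminus_ubfun.rep_eq minus_ubfun.rep_eq

lemma bdd_above_abs_ubfun: "bdd_above (range (\<lambda>x. \<bar>apply_ubfun f x\<bar>))"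
  using apply_ubfun_bounded[of f]
  by (auto simp: bounded_iff bdd_above_def)

instantiation ubfun :: (uniform_space) real_normed_vector
begin

definition norm_ubfun :: "'a ubfun \<Rightarrow> real"
  where "norm_ubfun f = (SUP x. \<bar>apply_ubfun f x\<bar>)"

definition dist_ubfun :: "'a ubfun \<Rightarrow> 'a ubfun \<Rightarrow> real"
  where "dist_ubfun f g = norm (f - g)"

definition sgn_ubfun :: "'a ubfun \<Rightarrow> 'a ubfun"
  where "sgn_ubfun f = f /\<^sub>R norm f"

definition uniformity_ubfun :: "('a ubfun \<times> 'a ubfun) filter"
  where "uniformity_ubfun = (INF e\<in>{0 <..}. principal {(f, g). dist f g < e})"

definition open_ubfun :: "'a ubfun set \<Rightarrow> bool"
  where "open_ubfun S = (\<forall>f\<in>S. \<forall>\<^sub>F (f', g) in uniformity. f' = f \<longrightarrow> g \<in> S)"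

lemma abs_apply_ubfun_le_norm: "\<bar>apply_ubfun f x\<bar> \<le> norm f" for f :: "'a ubfun"
  unfolding norm_ubfun_def by (rule cSUP_upper[OF UNIV_I bdd_above_abs_ubfun])

lemma norm_ubfun_le: "(\<And>x. \<bar>apply_ubfun f x\<bar> \<le> b) \<Longrightarrow> norm f \<le> b" for f :: "'a ubfun"
  unfolding norm_ubfun_def by (rule cSUP_least) auto

lemma norm_ubfun_eq_0: "norm f = 0 \<longleftrightarrow> f = 0" for f :: "'a ubfun"
proof
  assume "norm f = 0"
  then have "apply_ubfun f x = apply_ubfun 0 x" for x
    using abs_apply_ubfun_le_norm[of f x] by simp
  then show "f = 0" by (rule ubfun_eqI)
next
  assume "f = 0"
  then show "norm f = 0" unfolding norm_ubfun_def by simp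
qed

lemma norm_ubfun_add: "norm (f + g) \<le> norm f + norm g" for f g :: "'a ubfun"
proof (rule norm_ubfun_le)
  fix x show "\<bar>apply_ubfun (f + g) x\<bar> \<le> norm f + norm g"
    using abs_apply_ubfun_le_norm[of f x] abs_apply_ubfun_le_norm[of g x] by simp
qed

lemma norm_ubfun_scaleR: "norm (c *\<^sub>R f) = \<bar>c\<bar> * norm f" for f :: "'a ubfun"
proof (cases "c = 0")
  case True
  then show ?thesis by (simp add: norm_ubfun_eq_0)
next
  case False
  have le: "norm (c *\<^sub>R f) \<le> \<bar>c\<bar> * norm f" for c and f :: "'a ubfun"
    by (rule norm_ubfun_le) (simp add: abs_mult mult_left_mono abs_apply_ubfun_le_norm)
  have "norm f \<le> \<bar>inverse c\<bar> * norm (c *\<^sub>R f)"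
    using le[of "inverse c" "c *\<^sub>R f"] False by simp
  then have "\<bar>c\<bar> * norm f \<le> norm (c *\<^sub>R f)"
    using False by (simp add: field_simps)
  with le[of c f] show ?thesis by simp
qed

instance
  by standard
    (fact dist_ubfun_def sgn_ubfun_def uniformity_ubfun_def open_ubfun_def
      norm_ubfun_eq_0 norm_ubfun_add norm_ubfun_scaleR)+

end

section \<open>The norm dual and its weak* topology\<close>

type_synonym 'a ub_dual = "'a ubfun \<Rightarrow>\<^sub>L real"

text \<open>For real-valued operators the strong operator topology, i.e. the topology of pointwise
  convergence, is the weak* topology.\<close>

abbreviation weak_star :: "'a::uniform_space ub_dual topology" where
  "weak_star \<equiv> strong_operator_topology"

lift_definition point_mass :: "'a::uniform_space \<Rightarrow> 'a ub_dual" is "\<lambda>x f. apply_ubfun f x"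
  by (rule bounded_linear_intro[where K = 1]) (simp_all add: abs_apply_ubfun_le_norm)

definition closure_of_points :: "'a::uniform_space ub_dual set" where
  "closure_of_points = weak_star closure_of range point_mass"

section \<open>Lipschitz sets and uniform measures\<close>

definition uc_pseudometric :: "('a::uniform_space \<Rightarrow> 'a \<Rightarrow> real) \<Rightarrow> bool" where
  "uc_pseudometric \<Delta> \<longleftrightarrow>
    (\<forall>x y. 0 \<le> \<Delta> x y) \<and> (\<forall>x. \<Delta> x x = 0) \<and> (\<forall>x y. \<Delta> x y = \<Delta> y x) \<and>
    (\<forall>x y z. \<Delta> x z \<le> \<Delta> x y + \<Delta> y z) \<and>
    uniformly_continuous_on UNIV (\<lambda>(x, y). \<Delta> x y)"

definition Lip :: "('a \<Rightarrow> 'a \<Rightarrow> real) \<Rightarrow> ('a \<Rightarrow> real) set" where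
  "Lip \<Delta> = {f. range f \<subseteq> {-1..1} \<and> (\<forall>x x'. \<bar>f x - f x'\<bar> \<le> \<Delta> x x')}"

definition Lip_nonneg :: "('a \<Rightarrow> 'a \<Rightarrow> real) \<Rightarrow> ('a \<Rightarrow> real) set" where
  "Lip_nonneg \<Delta> = {f \<in> Lip \<Delta>. \<forall>x. 0 \<le> f x}"

lemma Lip_imp_ubfun:
  assumes \<Delta>: "uc_pseudometric \<Delta>" and f: "f \<in> Lip \<Delta>"
  shows "uniformly_continuous_on UNIV f \<and> bounded (range f)"
proof
  show "bounded (range f)"
    using f bounded_subset[OF bounded_closed_interval, of "range f" "-1" 1] by (simp add: Lip_def)
  show "uniformly_continuous_on UNIV f"
    unfolding uniformly_continuous_on_UNIV_metric
  proof (intro allI impI)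
    fix e :: real assume "e > 0"
    with \<Delta> have "\<forall>\<^sub>F ((x, y), (x', y')) in uniformity. dist (\<Delta> x y) (\<Delta> x' y') < e"
      by (auto simp: uc_pseudometric_def uniformly_continuous_on_UNIV_metric case_prod_unfold)
    then obtain P Q where "eventually P uniformity" "eventually Q uniformity"
      and PQ: "\<And>x x' y y'. P (x, x') \<Longrightarrow> Q (y, y') \<Longrightarrow> dist (\<Delta> x y) (\<Delta> x' y') < e"
      by (auto simp: uniformity_prod_def eventually_filtermap case_prod_unfold
          eventually_prod_filter)
    from this(1) show "\<forall>\<^sub>F (x, x') in uniformity. dist (f x) (f x') < e"
    proof eventually_elim
      case (elim z)
      obtain x x' where z: "z = (x, x')" by force
      have "dist (\<Delta> x x') (\<Delta> x' x') < e"
        using elim \<open>eventually Q uniformity\<close> by (intro PQ) (auto simp: z uniformity_refl)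
      then have "\<Delta> x x' < e"
        using \<Delta> by (auto simp: uc_pseudometric_def dist_real_def)
      moreover have "\<bar>f x - f x'\<bar> \<le> \<Delta> x x'"
        using f by (simp add: Lip_def)
      ultimately show ?case
        by (simp add: z dist_real_def)
    qed
  qed
qed

lemma apply_Ubfun_Lip [simp]:
  "uc_pseudometric \<Delta> \<Longrightarrow> f \<in> Lip \<Delta> \<Longrightarrow> apply_ubfun (Ubfun f) = f"
  using Lip_imp_ubfun by (auto intro: Ubfun_inverse)

text \<open>The type \<^typ>\<open>'a \<Rightarrow> real\<close> carries the product topology, so \<^const>\<open>continuous_on\<close> below refers to
  the topology of pointwise convergence.  Applying \<^const>\<open>Ubfun\<close> to elements of \<^term>\<open>Lip \<Delta>\<close> is
  legitimate by the preceding lemma.\<close>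

definition uniform_measures :: "'a::uniform_space ub_dual set" where
  "uniform_measures =
    {\<mu>. \<forall>\<Delta>. uc_pseudometric \<Delta> \<longrightarrow> continuous_on (Lip \<Delta>) (\<lambda>f. blinfun_apply \<mu> (Ubfun f))}"

section \<open>Convolution\<close>

lift_definition left_translate :: "'a::semiuniform_semigroup \<Rightarrow> 'a ubfun \<Rightarrow> 'a ubfun"
  is "\<lambda>x f y. f (x * y)"
proof (intro conjI)
  fix x :: 'a and f :: "'a \<Rightarrow> real"
  assume *: "uniformly_continuous_on UNIV f \<and> bounded (range f)"
  show "uniformly_continuous_on UNIV (\<lambda>y. f (x * y))"
    using * filterlim_compose[OF _ filterlim_uniformity_mult_left[of x],
        of "\<lambda>(x, y). (f x, f y)" uniformity]
    by (simp add: uniformly_continuous_on_uniformity case_prod_unfold)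
  show "bounded (range (\<lambda>y. f (x * y)))"
    using * by (meson bounded_subset image_subset_iff rangeI)
qed

lemma left_translate_linear:
  "left_translate x (f + g) = left_translate x f + left_translate x g"
  "left_translate x (c *\<^sub>R f) = c *\<^sub>R left_translate x f"
  by (auto intro!: ubfun_eqI simp: left_translate.rep_eq)

lemma norm_left_translate: "norm (left_translate x f) \<le> norm f"
  by (rule norm_ubfun_le) (simp add: left_translate.rep_eq abs_apply_ubfun_le_norm)

lemma abs_blinfun_left_translate_le:
  "\<bar>blinfun_apply \<nu> (left_translate x f)\<bar> \<le> norm \<nu> * norm f"
proof -
  have "\<bar>blinfun_apply \<nu> (left_translate x f)\<bar> \<le> norm \<nu> * norm (left_translate x f)"
    using norm_blinfun[of \<nu> "left_translate x f"] by simp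
  also have "\<dots> \<le> norm \<nu> * norm f"
    by (simp add: mult_left_mono norm_left_translate)
  finally show ?thesis .
qed

lift_definition conv_right :: "'a::semiuniform_semigroup ub_dual \<Rightarrow> 'a ubfun \<Rightarrow> 'a ubfun"
  is "\<lambda>\<nu> f x. blinfun_apply \<nu> (left_translate x f)"
proof (intro conjI)
  fix \<nu> :: "'a ub_dual" and f :: "'a ubfun"
  show "bounded (range (\<lambda>x. blinfun_apply \<nu> (left_translate x f)))"
    using abs_blinfun_left_translate_le[of \<nu> _ f] by (auto simp: bounded_iff)
  show "uniformly_continuous_on UNIV (\<lambda>x. blinfun_apply \<nu> (left_translate x f))"
    unfolding uniformly_continuous_on_UNIV_metric
  proof (intro allI impI)
    fix e :: real assume "e > 0"
    define d where "d = e / (norm \<nu> + 1)"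
    have pos: "norm \<nu> + 1 > 0" by (simp add: add_nonneg_pos)
    then have "d > 0" using \<open>e > 0\<close> by (simp add: d_def)
    then have "\<forall>\<^sub>F z in uniformity. dist (apply_ubfun f (fst z)) (apply_ubfun f (snd z)) < d"
      using apply_ubfun_uniformly_continuous[of f]
      by (auto simp: uniformly_continuous_on_UNIV_metric case_prod_unfold)
    then have "\<forall>\<^sub>F (x, x') in uniformity.
        \<forall>g\<in>range (\<lambda>y x. x * y). dist (apply_ubfun f (g x)) (apply_ubfun f (g x')) < d"
      using uniformly_equicontinuous_mult_right[where 'a = 'a]
      unfolding uniformly_equicontinuous_def
      by (elim allE[of _ "\<lambda>z. dist (apply_ubfun f (fst z)) (apply_ubfun f (snd z)) < d"]) simp
    then show "\<forall>\<^sub>F (x, x') in uniformity.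
        dist (blinfun_apply \<nu> (left_translate x f)) (blinfun_apply \<nu> (left_translate x' f)) < e"
    proof eventually_elim
      case (elim z)
      obtain x x' where z: "z = (x, x')" by force
      have "norm (left_translate x f - left_translate x' f) \<le> d"
        using elim
        by (intro norm_ubfun_le) (auto simp: z left_translate.rep_eq dist_real_def less_imp_le)
      then have "norm \<nu> * norm (left_translate x f - left_translate x' f) \<le> norm \<nu> * d"
        by (simp add: mult_left_mono)
      also have "\<dots> < (norm \<nu> + 1) * d"
        using \<open>d > 0\<close> by simp
      also have "\<dots> = e"
        using pos by (simp add: d_def)
      finally have "norm \<nu> * norm (left_translate x f - left_translate x' f) < e" .
      then show ?case
        using norm_blinfun[of \<nu> "left_translate x f - left_translate x' f"]
        by (simp add: z dist_real_def blinfun.diff_right)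
    qed
  qed
qed

lemma bounded_linear_conv_right: "bounded_linear (conv_right \<nu>)"
proof (rule bounded_linear_intro[where K = "norm \<nu>"])
  show "norm (conv_right \<nu> f) \<le> norm f * norm \<nu>" for f
    by (rule norm_ubfun_le)
      (simp add: conv_right.rep_eq abs_blinfun_left_translate_le mult.commute[of "norm f"])
qed (auto intro!: ubfun_eqI
    simp: conv_right.rep_eq left_translate_linear blinfun.add_right blinfun.scaleR_right)

definition convolution ::
    "'a::semiuniform_semigroup ub_dual \<Rightarrow> 'a ub_dual \<Rightarrow> 'a ub_dual" (infixl \<open>\<star>\<close> 70) where
  "\<mu> \<star> \<nu> = Blinfun (\<lambda>f. blinfun_apply \<mu> (conv_right \<nu> f))"

text \<open>The defining formula of convolution, with both inner functions written out.\<close>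

lemma convolution_apply:
  "blinfun_apply (\<mu> \<star> \<nu>) f =
    blinfun_apply \<mu> (Ubfun (\<lambda>x. blinfun_apply \<nu> (Ubfun (\<lambda>y. apply_ubfun f (x * y)))))"
proof -
  have left: "Ubfun (\<lambda>y. apply_ubfun f (x * y)) = left_translate x f" for x
    by (simp only: left_translate.rep_eq[symmetric] apply_ubfun_inverse)
  have right: "Ubfun (\<lambda>x. blinfun_apply \<nu> (left_translate x f)) = conv_right \<nu> f"
    by (simp only: conv_right.rep_eq[symmetric] apply_ubfun_inverse)
  have "bounded_linear (\<lambda>f. blinfun_apply \<mu> (conv_right \<nu> f))"
    by (rule bounded_linear_compose[OF blinfun.bounded_linear_right bounded_linear_conv_right])
  then show ?thesis
    unfolding convolution_def left right by (simp add: bounded_linear_Blinfun_apply)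
qed

section \<open>Ambitability\<close>

definition right_orbit :: "('a::times \<Rightarrow> real) \<Rightarrow> ('a \<Rightarrow> real) set" where
  "right_orbit f = range (\<lambda>x z. f (z * x))"

text \<open>The closure is taken in the product topology of the type \<^typ>\<open>'a \<Rightarrow> real\<close>.\<close>

definition ambitable :: "'a::semiuniform_semigroup itself \<Rightarrow> bool" where
  "ambitable _ \<longleftrightarrow>
    (\<forall>\<Delta> :: 'a \<Rightarrow> 'a \<Rightarrow> real. uc_pseudometric \<Delta> \<longrightarrow>
      (\<exists>f :: 'a ubfun. Lip_nonneg \<Delta> \<subseteq> closure (right_orbit (apply_ubfun f))))"

section \<open>Semigroups on a set and topological centres\<close>

definition semigroup_on :: "'s set \<Rightarrow> ('s \<Rightarrow> 's \<Rightarrow> 's) \<Rightarrow> bool" where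
  "semigroup_on S op \<longleftrightarrow>
    (\<forall>x\<in>S. \<forall>y\<in>S. op x y \<in> S) \<and>
    (\<forall>x\<in>S. \<forall>y\<in>S. \<forall>z\<in>S. op (op x y) z = op x (op y z))"

definition topological_center :: "'s topology \<Rightarrow> ('s \<Rightarrow> 's \<Rightarrow> 's) \<Rightarrow> 's set" where
  "topological_center T op = {x \<in> topspace T. continuous_map T T (op x)}"

end

theory Submission
  imports Defs
begin

text \<open>For fixed \<open>f\<close>, the convolution \<open>\<mu> \<star> \<nu>\<close> evaluated at \<open>f\<close> is \<open>\<mu>\<close> applied to the function
  \<open>conv_right \<nu> f = (x \<mapsto> \<nu>(y \<mapsto> f(xy)))\<close>, and \<open>\<nu> \<mapsto> conv_right \<nu> f\<close> is weak* to pointwise continuous.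
  So continuity of left convolution by \<open>\<mu>\<close> is a statement about the continuity of \<open>\<mu>\<close> for the pointwise
  topology, on sets of functions of the form \<open>conv_right \<nu> f\<close>; membership in \<open>uniform_measures\<close> is
  continuity for the same topology on Lipschitz sets.  The two kinds of sets are related as follows.

  If \<open>\<mu>\<close> is in the centre and \<open>\<Delta>\<close> is given, ambitability provides \<open>f\<close> whose orbit closure contains
  \<open>Lip_nonneg \<Delta>\<close>.  The orbit consists of the functions \<open>conv_right (point_mass x) f\<close>.  Since
  \<^const>\<open>closure_of_points\<close> is weak* compact (Alaoglu), its image under \<open>\<nu> \<mapsto> conv_right \<nu> f\<close> contains the
  orbit closure, and the map onto that image is a quotient map
  (\<open>quotient_map_conv_right\<close>).  Hence continuity of \<open>\<nu> \<mapsto> (\<mu> \<star> \<nu>) f\<close> on \<^const>\<open>closure_of_points\<close> descends to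
  continuity of \<open>\<mu>\<close> on \<open>Lip_nonneg \<Delta>\<close>, which an affine change of variable turns into
  continuity on \<open>Lip \<Delta>\<close>.

  Conversely, for norm-bounded \<open>\<nu>\<close> the functions \<open>conv_right \<nu> f\<close> lie in a multiple of \<open>Lip \<Delta>\<close> for one
  uniformly continuous pseudometric \<open>\<Delta>\<close>, so if \<open>\<mu>\<close> is a uniform measure then
  \<open>\<nu> \<mapsto> (\<mu> \<star> \<nu>) f\<close> is weak* continuous on norm-bounded sets.  The semigroup need not be
  norm-bounded, however, so more is required: this functional is evaluation at a single function
  \<open>g\<close> (\<open>convolution_uniform_measure\<close>).  The only candidate is \<open>g x = \<mu>(y \<mapsto> f(yx))\<close>, given by
  the point masses.  It is uniformly continuous by the continuity just described, applied to
  differences of two point masses.  The identity \<open>(\<mu> \<star> \<nu>) f = \<nu> g\<close> then holds on the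
  span of the point masses by linearity, and everywhere because every \<open>\<nu>\<close> is a weak* limit of
  elements of this span of norm at most \<open>norm \<nu>\<close> (\<open>approximation_by_point_masses\<close>, obtained from partitions of
  unity).\<close>

section \<open>Weak* compactness\<close>

lemma norm_blinfun_le_iff:
  fixes \<phi> :: "'b::real_normed_vector \<Rightarrow>\<^sub>L real"
  assumes "r \<ge> 0"
  shows "norm \<phi> \<le> r \<longleftrightarrow> (\<forall>f. \<bar>blinfun_apply \<phi> f\<bar> \<le> r * norm f)"
proof
  assume "norm \<phi> \<le> r"
  then show "\<forall>f. \<bar>blinfun_apply \<phi> f\<bar> \<le> r * norm f"
    using norm_blinfun[of \<phi>] by (metis mult_right_mono norm_ge_zero order_trans real_norm_def)
qed (use assms in \<open>auto intro!: norm_blinfun_bound\<close>)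

text \<open>Alaoglu's theorem for real functionals.  By Tychonoff's theorem the pointwise bounded functions form a compact
  set, the linear ones among them a closed subset \<open>P\<close>, and \<^const>\<open>Blinfun\<close> is continuous on \<open>P\<close>
  because both topologies are pointwise convergence.\<close>

lemma compactin_weak_star_ball:
  assumes "r \<ge> 0"
  shows "compactin strong_operator_topology
    {\<phi> :: 'b::real_normed_vector \<Rightarrow>\<^sub>L real. norm \<phi> \<le> r}"
proof -
  define K :: "('b \<Rightarrow> real) set" where "K = (\<Pi>\<^sub>E f\<in>UNIV. {- (r * norm f)..r * norm f})"
  define P where
    "P = {\<phi>\<in>K. (\<forall>f g. \<phi> (f + g) = \<phi> f + \<phi> g) \<and> (\<forall>c f. \<phi> (c *\<^sub>R f) = c * \<phi> f)}"
  have K: "compact K"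
    unfolding K_def compactin_euclidean_iff[symmetric] euclidean_product_topology[symmetric]
    by (simp add: compactin_PiE)
  have "closed (\<Inter>f g. {\<phi> :: 'b \<Rightarrow> real. \<phi> (f + g) = \<phi> f + \<phi> g})"
    "closed (\<Inter>c f. {\<phi> :: 'b \<Rightarrow> real. \<phi> (c *\<^sub>R f) = c * \<phi> f})"
    by (intro closed_INT ballI closed_Collect_eq continuous_intros
        continuous_on_product_coordinates)+
  from compact_Int_closed[OF compact_Int_closed[OF K this(1)] this(2)]
  have P: "compact P"
    by (rule back_subst[where P = compact]) (auto simp: P_def)
  have lin: "blinfun_apply (Blinfun \<phi>) = \<phi>" and le: "\<bar>\<phi> f\<bar> \<le> r * norm f" if "\<phi> \<in> P" for \<phi> f
  proof -
    show *: "\<bar>\<phi> f\<bar> \<le> r * norm f" for f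
      using that by (auto simp: P_def K_def PiE_iff abs_le_iff minus_le_iff)
    show "blinfun_apply (Blinfun \<phi>) = \<phi>"
      using that * by (intro bounded_linear_Blinfun_apply bounded_linear_intro[where K = r])
        (auto simp: P_def mult.commute)
  qed
  have "compactin (top_of_set P) P"
    using P by (simp add: compactin_subtopology)
  moreover have "continuous_map (top_of_set P) strong_operator_topology Blinfun"
    unfolding continuous_on_strong_operator_topo_iff_coordinatewise
    by (auto simp: lin intro: continuous_on_subset[OF continuous_on_product_coordinates]
        cong: continuous_on_cong)
  ultimately have "compactin strong_operator_topology (Blinfun ` P)"
    by (rule image_compactin)
  moreover have "Blinfun ` P = {\<phi> :: 'b \<Rightarrow>\<^sub>L real. norm \<phi> \<le> r}"
  proof (intro equalityI subsetI)
    fix \<phi> assume "\<phi> \<in> Blinfun ` P"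
    then show "\<phi> \<in> {\<phi>. norm \<phi> \<le> r}"
      using assms by (auto simp: norm_blinfun_le_iff lin le)
  next
    fix \<phi> :: "'b \<Rightarrow>\<^sub>L real" assume "\<phi> \<in> {\<phi>. norm \<phi> \<le> r}"
    then have "blinfun_apply \<phi> \<in> P"
      using assms by (auto simp: norm_blinfun_le_iff P_def K_def PiE_iff abs_le_iff minus_le_iff
          blinfun.add_right blinfun.scaleR_right)
    then show "\<phi> \<in> Blinfun ` P"
      by (metis blinfun_apply_inverse image_eqI)
  qed
  ultimately show ?thesis by simp
qed

lemma closedin_weak_star_ball:
  assumes "r \<ge> 0"
  shows "closedin strong_operator_topology
    {\<phi> :: 'b::real_normed_vector \<Rightarrow>\<^sub>L real. norm \<phi> \<le> r}"
proof -
  have "closedin strong_operator_topology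
      (\<Inter>f. {\<phi> \<in> topspace strong_operator_topology.
        blinfun_apply \<phi> f \<in> {- (r * norm (f :: 'b))..r * norm f}})"
    by (intro closedin_INT
        closedin_continuous_map_preimage[OF strong_operator_topology_continuous_evaluation]) auto
  also have "\<dots> = {\<phi> :: 'b \<Rightarrow>\<^sub>L real. norm \<phi> \<le> r}"
    using assms
    by (auto simp: norm_blinfun_le_iff abs_le_iff minus_le_iff strong_operator_topology_topspace)
  finally show ?thesis .
qed

lemma point_mass_apply [simp]: "blinfun_apply (point_mass x) f = apply_ubfun f x"
  by (simp add: point_mass.rep_eq)

lemma norm_point_mass_le: "norm (point_mass x) \<le> 1"
  by (rule norm_blinfun_bound) (simp_all add: abs_apply_ubfun_le_norm)

lemma compactin_closure_of_points: "compactin weak_star closure_of_points"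
proof (rule closed_compactin[OF compactin_weak_star_ball[OF zero_le_one]])
  show "closure_of_points \<subseteq> {\<phi>. norm \<phi> \<le> 1}"
    unfolding closure_of_points_def
    by (rule closure_of_minimal[OF _ closedin_weak_star_ball[OF zero_le_one]]) (auto simp: norm_point_mass_le)
  show "closedin weak_star closure_of_points"
    by (simp add: closure_of_points_def)
qed

section \<open>Convolution as a composition\<close>

lemma conv_right_apply: "apply_ubfun (conv_right \<nu> f) x = blinfun_apply \<nu> (left_translate x f)"
  by (simp add: conv_right.rep_eq)

lemma conv_right_point_mass:
  "apply_ubfun (conv_right (point_mass x) f) = (\<lambda>z. apply_ubfun f (z * x))"
  by (simp add: conv_right_apply left_translate.rep_eq fun_eq_iff)

lemma convolution_conv_right: "blinfun_apply (\<mu> \<star> \<nu>) f = blinfun_apply \<mu> (conv_right \<nu> f)"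
  unfolding convolution_def
  by (rule bounded_linear_Blinfun_apply[THEN fun_cong])
    (rule bounded_linear_compose[OF blinfun.bounded_linear_right bounded_linear_conv_right])

lemma linear_conv_right: "linear (\<lambda>\<nu>. conv_right \<nu> f)"
  by (rule linearI) (auto intro!: ubfun_eqI simp: conv_right_apply blinfun.add_left blinfun.scaleR_left)

lemma norm_conv_right_le: "norm (conv_right \<nu> f) \<le> norm \<nu> * norm f"
  by (rule norm_ubfun_le) (simp add: conv_right_apply abs_blinfun_left_translate_le)

section \<open>From continuity of convolution to uniform measures\<close>

lemma right_orbit_eq: "right_orbit (apply_ubfun f) = (\<lambda>\<nu>. apply_ubfun (conv_right \<nu> f)) ` range point_mass"
  by (simp add: right_orbit_def conv_right_point_mass image_image)

lemma continuous_map_conv_right: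
  "continuous_map weak_star euclidean (\<lambda>\<nu>. apply_ubfun (conv_right \<nu> f))"
  unfolding euclidean_product_topology[symmetric] continuous_map_componentwise_UNIV
  by (simp add: conv_right_apply strong_operator_topology_continuous_evaluation)

lemma Hausdorff_space_fun:
  "Hausdorff_space (euclidean :: ('a \<Rightarrow> real) topology)"
  unfolding euclidean_product_topology[symmetric]
  by (simp add: Hausdorff_space_product_topology)

text \<open>A continuous map from a compact space onto a Hausdorff space is a quotient map.  This is what lets
  continuity of \<open>\<nu> \<mapsto> \<mu> (conv_right \<nu> f)\<close> be read as continuity of \<open>\<mu>\<close> on the image functions.\<close>

lemma quotient_map_conv_right:
  "quotient_map (subtopology weak_star closure_of_points)
     (top_of_set ((\<lambda>\<nu>. apply_ubfun (conv_right \<nu> f)) ` closure_of_points))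
     (\<lambda>\<nu>. apply_ubfun (conv_right \<nu> f))"
proof (rule continuous_imp_quotient_map)
  show "continuous_map (subtopology weak_star closure_of_points)
     (top_of_set ((\<lambda>\<nu>. apply_ubfun (conv_right \<nu> f)) ` closure_of_points))
     (\<lambda>\<nu>. apply_ubfun (conv_right \<nu> f))"
    by (auto simp: continuous_map_in_subtopology continuous_map_from_subtopology
        continuous_map_conv_right)
  show "compact_space (subtopology weak_star (closure_of_points :: 'a ub_dual set))"
    by (simp add: compact_space_subtopology compactin_closure_of_points)
qed (auto simp: Hausdorff_space_subtopology Hausdorff_space_fun strong_operator_topology_topspace)

text \<open>The image of the compact set \<^const>\<open>closure_of_points\<close> is compact, hence closed, and it contains the orbit
  as the image of the point masses.\<close>

lemma closure_right_orbit_subset: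
  "closure (right_orbit (apply_ubfun f)) \<subseteq> (\<lambda>\<nu>. apply_ubfun (conv_right \<nu> f)) ` closure_of_points"
proof (rule closure_minimal)
  show "right_orbit (apply_ubfun f) \<subseteq> (\<lambda>\<nu>. apply_ubfun (conv_right \<nu> f)) ` closure_of_points"
    unfolding right_orbit_eq closure_of_points_def
    by (intro image_mono closure_of_subset) (simp add: strong_operator_topology_topspace)
  have "compactin euclidean ((\<lambda>\<nu>. apply_ubfun (conv_right \<nu> f)) ` closure_of_points)"
    by (rule image_compactin[OF compactin_closure_of_points continuous_map_conv_right])
  then show "closed ((\<lambda>\<nu>. apply_ubfun (conv_right \<nu> f)) ` closure_of_points)"
    using compactin_imp_closedin[OF Hausdorff_space_fun] by simp
qed

text \<open>The affine map \<open>f \<mapsto> (1 + f) / 2\<close> sends \<open>Lip \<Delta>\<close> continuously into \<open>Lip_nonneg \<Delta>\<close>, and \<open>\<mu>\<close>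
  at \<open>f\<close> is recovered from \<open>\<mu>\<close> at the image by linearity.\<close>

lemma continuous_on_Lip_if_Lip_nonneg:
  fixes \<mu> :: "'a::uniform_space ub_dual"
  assumes \<Delta>: "uc_pseudometric \<Delta>"
    and cont: "continuous_on (Lip_nonneg \<Delta>) (\<lambda>f. blinfun_apply \<mu> (Ubfun f))"
  shows "continuous_on (Lip \<Delta>) (\<lambda>f. blinfun_apply \<mu> (Ubfun f))"
proof -
  define s :: "('a \<Rightarrow> real) \<Rightarrow> 'a \<Rightarrow> real" where "s f x = (1 + f x) / 2" for f x
  define one :: "'a \<Rightarrow> real" where "one = (\<lambda>_. 1)"
  have one: "one \<in> Lip \<Delta>"
    using \<Delta> by (auto simp: Lip_def uc_pseudometric_def one_def)
  have s: "s f \<in> Lip_nonneg \<Delta>" if f: "f \<in> Lip \<Delta>" for f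
  proof -
    have range: "- 1 \<le> f x" "f x \<le> 1" for x
      using f by (auto simp: Lip_def image_subset_iff)
    have "\<bar>s f x - s f y\<bar> \<le> \<Delta> x y" for x y
    proof -
      have "\<bar>s f x - s f y\<bar> = \<bar>f x - f y\<bar> / 2"
        by (simp add: s_def diff_divide_distrib[symmetric])
      also have "\<dots> \<le> \<bar>f x - f y\<bar>" by simp
      also have "\<dots> \<le> \<Delta> x y" using f by (simp add: Lip_def)
      finally show ?thesis .
    qed
    moreover have "0 \<le> s f x" "- 1 \<le> s f x" "s f x \<le> 1" for x
      using range[of x] by (auto simp: s_def)
    ultimately show ?thesis
      by (auto simp: Lip_nonneg_def Lip_def)
  qed
  have eq: "blinfun_apply \<mu> (Ubfun f) = 2 * blinfun_apply \<mu> (Ubfun (s f)) - blinfun_apply \<mu> (Ubfun one)"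
    if f: "f \<in> Lip \<Delta>" for f
  proof -
    have "Ubfun f = 2 *\<^sub>R Ubfun (s f) - Ubfun one"
      using \<Delta> f s[OF f] one by (intro ubfun_eqI) (simp add: Lip_nonneg_def s_def one_def field_simps)
    then show ?thesis
      by (simp add: blinfun.diff_right blinfun.scaleR_right)
  qed
  have "continuous_on (Lip \<Delta>) s"
    unfolding s_def
    by (intro continuous_on_coordinatewise_then_product continuous_intros
        continuous_on_subset[OF continuous_on_product_coordinates]) auto
  then have "continuous_on (Lip \<Delta>) (\<lambda>f. blinfun_apply \<mu> (Ubfun (s f)))"
    using s by (intro continuous_on_compose2[OF cont]) auto
  then have "continuous_on (Lip \<Delta>)
      (\<lambda>f. 2 * blinfun_apply \<mu> (Ubfun (s f)) - blinfun_apply \<mu> (Ubfun one))"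
    by (intro continuous_on_diff continuous_on_mult continuous_on_const)
  then show ?thesis
    by (rule continuous_on_eq) (simp add: eq)
qed

text \<open>The functional \<open>\<nu> \<mapsto> (\<mu> \<star> \<nu>) f\<close> is \<open>\<mu>\<close> composed with the quotient map \<open>\<nu> \<mapsto> conv_right \<nu> f\<close>, and
  ambitability provides \<open>f\<close> for which the image of this map contains \<open>Lip_nonneg \<Delta>\<close>.\<close>

lemma continuous_convolution_imp_uniform_measure:
  fixes \<mu> :: "'a::semiuniform_semigroup ub_dual"
  assumes amb: "ambitable TYPE('a)"
    and cont: "continuous_map (subtopology weak_star closure_of_points) weak_star ((\<star>) \<mu>)"
  shows "\<mu> \<in> uniform_measures"
  unfolding uniform_measures_def
proof (intro CollectI allI impI)
  fix \<Delta> :: "'a \<Rightarrow> 'a \<Rightarrow> real" assume \<Delta>: "uc_pseudometric \<Delta>"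
  with amb obtain f :: "'a ubfun" where f: "Lip_nonneg \<Delta> \<subseteq> closure (right_orbit (apply_ubfun f))"
    by (auto simp: ambitable_def)
  let ?T = "\<lambda>\<nu>. apply_ubfun (conv_right \<nu> f)"
  have "continuous_map (subtopology weak_star closure_of_points) euclidean
      (\<lambda>\<nu>. blinfun_apply (\<mu> \<star> \<nu>) f)"
    using cont unfolding continuous_on_strong_operator_topo_iff_coordinatewise by blast
  also have "(\<lambda>\<nu>. blinfun_apply (\<mu> \<star> \<nu>) f) = (\<lambda>h. blinfun_apply \<mu> (Ubfun h)) \<circ> ?T"
    by (simp add: convolution_conv_right apply_ubfun_inverse comp_def)
  finally have "continuous_map (top_of_set (?T ` closure_of_points)) euclidean
      (\<lambda>h. blinfun_apply \<mu> (Ubfun h))"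
    by (rule continuous_compose_quotient_map[OF quotient_map_conv_right])
  then have "continuous_on (?T ` closure_of_points) (\<lambda>h. blinfun_apply \<mu> (Ubfun h))"
    by simp
  moreover have "Lip_nonneg \<Delta> \<subseteq> ?T ` closure_of_points"
    using f closure_right_orbit_subset[of f] by simp
  ultimately have "continuous_on (Lip_nonneg \<Delta>) (\<lambda>h. blinfun_apply \<mu> (Ubfun h))"
    by (rule continuous_on_subset)
  with \<Delta> show "continuous_on (Lip \<Delta>) (\<lambda>h. blinfun_apply \<mu> (Ubfun h))"
    by (rule continuous_on_Lip_if_Lip_nonneg)
qed

section \<open>Approximation by combinations of point masses\<close>

lift_definition pos_part :: "'a::uniform_space ubfun \<Rightarrow> 'a ubfun" is "\<lambda>f x. max 0 (f x)"
proof
  fix f :: "'a \<Rightarrow> real"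
  assume *: "uniformly_continuous_on UNIV f \<and> bounded (range f)"
  have le: "dist (max 0 a) (max 0 b) \<le> dist a b" for a b :: real
    by (auto simp: dist_real_def max_def)
  show "uniformly_continuous_on UNIV (\<lambda>x. max 0 (f x))"
    unfolding uniformly_continuous_on_UNIV_metric
  proof (intro allI impI)
    fix e :: real assume "e > 0"
    with * have "\<forall>\<^sub>F (x, x') in uniformity. dist (f x) (f x') < e"
      by (auto simp: uniformly_continuous_on_UNIV_metric)
    then show "\<forall>\<^sub>F (x, x') in uniformity. dist (max 0 (f x)) (max 0 (f x')) < e"
      by eventually_elim (auto intro: le_less_trans[OF le])
  qed
  from * obtain b where "\<And>x. \<bar>f x\<bar> \<le> b"
    by (auto simp: bounded_iff)
  then have "\<And>x. \<bar>max 0 (f x)\<bar> \<le> b"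
    by (metis abs_ge_zero abs_of_nonneg max_def order_trans abs_zero)
  then show "bounded (range (\<lambda>x. max 0 (f x)))"
    by (auto simp: bounded_iff)
qed

lift_definition const_ubfun :: "real \<Rightarrow> 'a::uniform_space ubfun" is "\<lambda>c _. c"
  by (auto simp: uniformly_continuous_on_UNIV_metric case_prod_unfold)

lemma apply_ubfun_sum: "apply_ubfun (\<Sum>a\<in>A. f a) x = (\<Sum>a\<in>A. apply_ubfun (f a) x)"
  by (induction A rule: infinite_finite_induct) auto

text \<open>The functions are added one at a time: the new member is the part of \<open>q b\<close> that exceeds the current
  sum, so the sum becomes the maximum of itself and \<open>q b\<close>.  The resulting sum is the pointwise
  maximum of \<open>0\<close> and the \<open>q a\<close>.  Unlike a normalisation by division, these operations visibly preserve
  uniform continuity.\<close>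

lemma subordinate_partition:
  fixes q :: "'b \<Rightarrow> 'a::uniform_space ubfun"
  assumes "finite A" and "\<And>a x. a \<in> A \<Longrightarrow> apply_ubfun (q a) x \<le> 1"
  shows "\<exists>p :: 'b \<Rightarrow> 'a ubfun.
    (\<forall>a x. 0 \<le> apply_ubfun (p a) x) \<and>
    (\<forall>a\<in>A. \<forall>x. apply_ubfun (q a) x \<le> 0 \<longrightarrow> apply_ubfun (p a) x = 0) \<and>
    (\<forall>x. (\<Sum>a\<in>A. apply_ubfun (p a) x) \<le> 1) \<and>
    (\<forall>a\<in>A. \<forall>x. apply_ubfun (q a) x \<le> (\<Sum>a\<in>A. apply_ubfun (p a) x))"
  using assms
proof (induction A rule: finite_induct)
  case empty
  show ?case by (rule exI[of _ "\<lambda>_. 0"]) simp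
next
  case (insert b A)
  then obtain p :: "'b \<Rightarrow> 'a ubfun" where p:
    "\<And>a x. 0 \<le> apply_ubfun (p a) x"
    "\<And>a x. a \<in> A \<Longrightarrow> apply_ubfun (q a) x \<le> 0 \<Longrightarrow> apply_ubfun (p a) x = 0"
    "\<And>x. (\<Sum>a\<in>A. apply_ubfun (p a) x) \<le> 1"
    "\<And>a x. a \<in> A \<Longrightarrow> apply_ubfun (q a) x \<le> (\<Sum>a\<in>A. apply_ubfun (p a) x)"
    by (metis insertI2)
  define p' where "p' = p(b := pos_part (q b - (\<Sum>a\<in>A. p a)))"
  have p'_b: "apply_ubfun (p' b) x
      = max 0 (apply_ubfun (q b) x - (\<Sum>a\<in>A. apply_ubfun (p a) x))" for x
    by (simp add: p'_def pos_part.rep_eq apply_ubfun_sum)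
  have p'_A: "p' a = p a" if "a \<in> A" for a
    using that insert.hyps by (auto simp: p'_def)
  have sum: "(\<Sum>a\<in>insert b A. apply_ubfun (p' a) x)
      = max (\<Sum>a\<in>A. apply_ubfun (p a) x) (apply_ubfun (q b) x)" for x
    using insert.hyps by (simp add: p'_b p'_A)
  have nonneg: "0 \<le> (\<Sum>a\<in>A. apply_ubfun (p a) x)" for x
    by (intro sum_nonneg p)
  show ?case
  proof (intro exI[of _ p'] conjI allI ballI impI)
    show "0 \<le> apply_ubfun (p' a) x" for a x
      using p(1) p'_b by (cases "a = b") (auto simp: p'_def)
    show "apply_ubfun (p' a) x = 0" if "a \<in> insert b A" "apply_ubfun (q a) x \<le> 0" for a x
      using that p(2)[of a x] nonneg[of x] p'_b[of x] p'_A[of a] by auto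
    show "(\<Sum>a\<in>insert b A. apply_ubfun (p' a) x) \<le> 1" for x
      using p(3)[of x] insert.prems[of b x] by (simp only: sum) auto
    show "apply_ubfun (q a) x \<le> (\<Sum>a\<in>insert b A. apply_ubfun (p' a) x)"
      if "a \<in> insert b A" for a x
      using p(4)[of a x] that by (simp only: sum) auto
  qed
qed

text \<open>Rounding the values of the finitely many bounded functions to multiples of \<open>e\<close> leaves finitely many
  patterns; one point is chosen for each pattern that occurs.\<close>

lemma finite_net:
  fixes G :: "'a::uniform_space ubfun set"
  assumes "finite G" and "e > 0"
  shows "\<exists>A. finite A \<and> (\<forall>x. \<exists>a\<in>A. \<forall>g\<in>G. \<bar>apply_ubfun g x - apply_ubfun g a\<bar> < e)"
proof -
  define k where "k x = (\<lambda>g\<in>G. \<lfloor>apply_ubfun g x / e\<rfloor>)" for x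
  define r where "r v = (SOME x. k x = v)" for v
  have "range k \<subseteq> (\<Pi>\<^sub>E g\<in>G. {\<lfloor>- norm g / e\<rfloor>..\<lfloor>norm g / e\<rfloor>})"
  proof -
    have "- norm g / e \<le> apply_ubfun g x / e" "apply_ubfun g x / e \<le> norm g / e" for g x
      by (rule divide_right_mono; use abs_apply_ubfun_le_norm[of g x] \<open>e > 0\<close> in linarith)+
    then show ?thesis
      by (auto simp: k_def intro!: floor_mono)
  qed
  moreover have "finite (\<Pi>\<^sub>E g\<in>G. {\<lfloor>- norm g / e\<rfloor>..\<lfloor>norm g / e\<rfloor>})"
    using \<open>finite G\<close> by (intro finite_PiE) auto
  ultimately have fin: "finite (range k)"
    by (rule finite_subset)
  have r: "k (r (k x)) = k x" for x
    unfolding r_def by (rule someI[of _ x]) simp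
  have "\<bar>apply_ubfun g x - apply_ubfun g (r (k x))\<bar> < e" if "g \<in> G" for g x
  proof -
    have "\<lfloor>apply_ubfun g (r (k x)) / e\<rfloor> = \<lfloor>apply_ubfun g x / e\<rfloor>"
      using fun_cong[OF r[of x], of g] that by (simp add: k_def)
    then have "\<bar>apply_ubfun g x / e - apply_ubfun g (r (k x)) / e\<bar> < 1"
      by linarith
    then show ?thesis
      using \<open>e > 0\<close> by (simp add: diff_divide_distrib[symmetric] abs_divide)
  qed
  then show ?thesis
    using fin by (intro exI[of _ "r ` range k"]) auto
qed

text \<open>With \<open>d a\<close> the sum of the differences \<open>\<bar>g - g a\<bar>\<close> over \<open>g \<in> G\<close>, the trapezoid \<open>q a\<close> equals \<open>1\<close> where
  \<open>d a \<le> e / 2\<close> and is positive only where \<open>d a < e\<close>.  For a fine enough net \<open>A\<close> some \<open>q a\<close> is \<open>1\<close> at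
  every point, so the subordinate functions add up to exactly \<open>1\<close>.\<close>

lemma partition_of_unity:
  fixes G :: "'a::uniform_space ubfun set"
  assumes G: "finite G" and "e > 0"
  shows "\<exists>A (p :: 'a \<Rightarrow> 'a ubfun). finite A \<and>
    (\<forall>a x. 0 \<le> apply_ubfun (p a) x) \<and> (\<forall>x. (\<Sum>a\<in>A. apply_ubfun (p a) x) = 1) \<and>
    (\<forall>a\<in>A. \<forall>x. \<forall>g\<in>G. apply_ubfun (p a) x \<noteq> 0 \<longrightarrow> \<bar>apply_ubfun g x - apply_ubfun g a\<bar> < e)"
proof -
  define \<eta> where "\<eta> = e / 2"
  define n where "n = real (card G) + 1"
  have \<eta>: "\<eta> > 0" "e = 2 * \<eta>" and "n > 0"
    using \<open>e > 0\<close> by (auto simp: \<eta>_def n_def)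
  then obtain A where A: "finite A"
    and near: "\<And>x. \<exists>a\<in>A. \<forall>g\<in>G. \<bar>apply_ubfun g x - apply_ubfun g a\<bar> < \<eta> / n"
    using finite_net[OF G, of "\<eta> / n"] by auto
  define d :: "'a \<Rightarrow> 'a ubfun" where "d a = (\<Sum>g\<in>G. pos_part (g - const_ubfun (apply_ubfun g a))
      + pos_part (const_ubfun (apply_ubfun g a) - g))" for a
  have d: "apply_ubfun (d a) x = (\<Sum>g\<in>G. \<bar>apply_ubfun g x - apply_ubfun g a\<bar>)" for a x
    unfolding d_def apply_ubfun_sum
    by (intro sum.cong) (auto simp: pos_part.rep_eq const_ubfun.rep_eq)
  define q where "q a = const_ubfun 1 - (1 / \<eta>) *\<^sub>R pos_part (d a - const_ubfun \<eta>)" for a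
  have q: "apply_ubfun (q a) x = 1 - max 0 (apply_ubfun (d a) x - \<eta>) / \<eta>" for a x
    by (simp add: q_def pos_part.rep_eq const_ubfun.rep_eq)
  have q_le: "apply_ubfun (q a) x \<le> 1" for a x
    using \<eta> by (simp add: q)
  obtain p where p:
    "\<And>a x. 0 \<le> apply_ubfun (p a) x"
    "\<And>a x. a \<in> A \<Longrightarrow> apply_ubfun (q a) x \<le> 0 \<Longrightarrow> apply_ubfun (p a) x = 0"
    "\<And>x. (\<Sum>a\<in>A. apply_ubfun (p a) x) \<le> 1"
    "\<And>a x. a \<in> A \<Longrightarrow> apply_ubfun (q a) x \<le> (\<Sum>a\<in>A. apply_ubfun (p a) x)"
    using subordinate_partition[of A q, OF A q_le] by blast
  have "(\<Sum>a\<in>A. apply_ubfun (p a) x) = 1" for x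
  proof (rule antisym[OF p(3)])
    obtain a where a: "a \<in> A" "\<And>g. g \<in> G \<Longrightarrow> \<bar>apply_ubfun g x - apply_ubfun g a\<bar> \<le> \<eta> / n"
      using near[of x] by (meson less_imp_le)
    have "apply_ubfun (d a) x \<le> real (card G) * (\<eta> / n)"
      unfolding d using a(2) by (rule sum_bounded_above)
    also have "\<dots> \<le> \<eta>"
      using \<eta> \<open>n > 0\<close> by (simp add: n_def field_simps)
    finally have "apply_ubfun (q a) x = 1"
      by (simp add: q)
    then show "1 \<le> (\<Sum>a\<in>A. apply_ubfun (p a) x)"
      using p(4)[OF a(1), of x] by simp
  qed
  moreover have "\<bar>apply_ubfun g x - apply_ubfun g a\<bar> < e"
    if "a \<in> A" "g \<in> G" "apply_ubfun (p a) x \<noteq> 0" for a x g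
  proof -
    have "apply_ubfun (q a) x > 0"
      using p(2)[of a x] that by force
    then have "apply_ubfun (d a) x < e"
      using \<eta> by (simp add: q field_simps)
    moreover have "\<bar>apply_ubfun g x - apply_ubfun g a\<bar> \<le> apply_ubfun (d a) x"
      unfolding d using G that by (intro member_le_sum) auto
    ultimately show ?thesis by simp
  qed
  ultimately show ?thesis
    using A p(1) by blast
qed

text \<open>A partition of unity that is fine for \<open>G\<close> gives the averaging operator \<open>P h = (\<Sum>a\<in>A. h a *\<^sub>R p a)\<close>,
  which has norm at most \<open>1\<close> and moves every member of \<open>G\<close> by little.  The composition of \<open>\<nu>\<close> with \<open>P\<close> is
  a combination of point masses with coefficients \<open>\<nu> (p a)\<close>.  The norm bound is essential later, because uniform
  measures control convolution only on norm-bounded sets.\<close>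

lemma approximation_by_point_masses:
  fixes \<nu> :: "'a::uniform_space ub_dual"
  assumes "finite G" and "e > 0"
  shows "\<exists>\<sigma>\<in>span (range point_mass). norm \<sigma> \<le> norm \<nu> \<and>
    (\<forall>g\<in>G. \<bar>blinfun_apply (\<nu> - \<sigma>) g\<bar> < e)"
proof -
  define e' where "e' = e / (norm \<nu> + 1)"
  have pos: "norm \<nu> + 1 > 0" by (simp add: add_nonneg_pos)
  then have "e' > 0" using \<open>e > 0\<close> by (simp add: e'_def)
  obtain A and p :: "'a \<Rightarrow> 'a ubfun" where "finite A"
    and p_nonneg: "\<And>a x. 0 \<le> apply_ubfun (p a) x"
    and p_sum: "\<And>x. (\<Sum>a\<in>A. apply_ubfun (p a) x) = 1"
    and p_supp: "\<And>a x g. a \<in> A \<Longrightarrow> g \<in> G \<Longrightarrow> apply_ubfun (p a) x \<noteq> 0 \<Longrightarrow>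
        \<bar>apply_ubfun g x - apply_ubfun g a\<bar> < e'"
    using partition_of_unity[OF \<open>finite G\<close> \<open>e' > 0\<close>] by blast
  define P where "P h = (\<Sum>a\<in>A. apply_ubfun h a *\<^sub>R p a)" for h
  define \<sigma> where "\<sigma> = (\<Sum>a\<in>A. blinfun_apply \<nu> (p a) *\<^sub>R point_mass a)"
  have \<sigma>: "blinfun_apply \<sigma> h = blinfun_apply \<nu> (P h)" for h
    by (simp add: \<sigma>_def P_def blinfun.sum_left blinfun.sum_right blinfun.scaleR_left
        blinfun.scaleR_right mult.commute)
  have average: "\<bar>\<Sum>a\<in>A. c a * apply_ubfun (p a) x\<bar> \<le> K"
    if "\<And>a. a \<in> A \<Longrightarrow> apply_ubfun (p a) x \<noteq> 0 \<Longrightarrow> \<bar>c a\<bar> \<le> K" for c K x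
  proof -
    have "\<bar>\<Sum>a\<in>A. c a * apply_ubfun (p a) x\<bar> \<le> (\<Sum>a\<in>A. \<bar>c a * apply_ubfun (p a) x\<bar>)"
      by (rule sum_abs)
    also have "\<dots> \<le> (\<Sum>a\<in>A. K * apply_ubfun (p a) x)"
    proof (rule sum_mono)
      fix a assume "a \<in> A"
      then show "\<bar>c a * apply_ubfun (p a) x\<bar> \<le> K * apply_ubfun (p a) x"
        using that[of a] p_nonneg[of a x]
        by (cases "apply_ubfun (p a) x = 0") (auto simp: abs_mult mult_right_mono)
    qed
    also have "\<dots> = K"
      by (simp add: sum_distrib_left[symmetric] p_sum)
    finally show ?thesis .
  qed
  have "norm \<sigma> \<le> norm \<nu>"
  proof (rule norm_blinfun_bound)
    fix h
    have "norm (P h) \<le> norm h"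
      unfolding P_def
      by (rule norm_ubfun_le) (simp add: apply_ubfun_sum average abs_apply_ubfun_le_norm)
    then have "norm \<nu> * norm (P h) \<le> norm \<nu> * norm h"
      by (rule mult_left_mono) simp
    then show "norm (blinfun_apply \<sigma> h) \<le> norm \<nu> * norm h"
      using norm_blinfun[of \<nu> "P h"] by (simp add: \<sigma>)
  qed simp
  moreover have "\<bar>blinfun_apply (\<nu> - \<sigma>) g\<bar> < e" if "g \<in> G" for g
  proof -
    have "norm (g - P g) \<le> e'"
    proof (rule norm_ubfun_le)
      fix x
      have "apply_ubfun (g - P g) x
          = (\<Sum>a\<in>A. (apply_ubfun g x - apply_ubfun g a) * apply_ubfun (p a) x)"
        by (simp add: P_def apply_ubfun_sum left_diff_distrib sum_subtractf
            sum_distrib_left[symmetric] p_sum)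
      then show "\<bar>apply_ubfun (g - P g) x\<bar> \<le> e'"
        using p_supp[OF _ that] by (simp add: average less_imp_le)
    qed
    then have "norm \<nu> * norm (g - P g) \<le> norm \<nu> * e'"
      by (rule mult_left_mono) simp
    also have "\<dots> < (norm \<nu> + 1) * e'"
      using \<open>e' > 0\<close> by simp
    also have "\<dots> = e"
      using pos by (simp add: e'_def)
    finally show ?thesis
      using norm_blinfun[of \<nu> "g - P g"]
      by (simp add: \<sigma> blinfun.diff_left blinfun.diff_right)
  qed
  moreover have "\<sigma> \<in> span (range point_mass)"
    unfolding \<sigma>_def by (intro span_sum span_scale span_base) auto
  ultimately show ?thesis by blast
qed

section \<open>From uniform measures to continuity of convolution\<close>

lemma uc_pseudometricI:
  fixes \<Delta> :: "'a::uniform_space \<Rightarrow> 'a \<Rightarrow> real"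
  assumes nonneg: "\<And>x y. 0 \<le> \<Delta> x y" and refl: "\<And>x. \<Delta> x x = 0"
    and sym: "\<And>x y. \<Delta> x y = \<Delta> y x"
    and tri: "\<And>x y z. \<Delta> x z \<le> \<Delta> x y + \<Delta> y z"
    and small: "\<And>e. e > 0 \<Longrightarrow> \<forall>\<^sub>F (x, x') in uniformity. \<Delta> x x' < e"
  shows "uc_pseudometric \<Delta>"
proof -
  have "uniformly_continuous_on UNIV (\<lambda>(x, y). \<Delta> x y)"
    unfolding uniformly_continuous_on_UNIV_metric
  proof (intro allI impI)
    fix e :: real assume "e > 0"
    then have ev: "\<forall>\<^sub>F (x, x') in uniformity. \<Delta> x x' < e / 2"
      by (intro small) simp
    have le: "dist (\<Delta> x y) (\<Delta> x' y') \<le> \<Delta> x x' + \<Delta> y y'" for x x' y y'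
      using tri[of x y x'] tri[of x' y y'] tri[of x' y' x] tri[of x y' y] sym[of x' x] sym[of y' y]
      unfolding dist_real_def by linarith
    have "\<forall>\<^sub>F u in uniformity \<times>\<^sub>F uniformity.
        \<Delta> (fst (fst u)) (snd (fst u)) < e / 2 \<and> \<Delta> (fst (snd u)) (snd (snd u)) < e / 2"
      using eventually_prodI[OF ev ev] by (simp add: case_prod_unfold)
    then show "\<forall>\<^sub>F (z, z') in uniformity. dist (case z of (x, y) \<Rightarrow> \<Delta> x y) (case z' of (x, y) \<Rightarrow> \<Delta> x y) < e"
      unfolding uniformity_prod_def eventually_filtermap
    proof eventually_elim
      case (elim u)
      then show ?case
        using le[of "fst (fst u)" "fst (snd u)" "snd (fst u)" "snd (snd u)"]
        by (simp add: case_prod_unfold)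
    qed
  qed
  then show ?thesis
    unfolding uc_pseudometric_def using nonneg refl sym tri by blast
qed

text \<open>The least pseudometric for which all right translates of \<open>f\<close> are \<open>1\<close>-Lipschitz: it is the supremum
  of \<open>\<bar>f (x * y) - f (x' * y)\<bar>\<close> over \<open>y\<close>.\<close>

definition orbit_dist :: "'a::semiuniform_semigroup ubfun \<Rightarrow> 'a \<Rightarrow> 'a \<Rightarrow> real" where
  "orbit_dist f x x' = norm (left_translate x f - left_translate x' f)"

text \<open>Uniform continuity is the equicontinuity of the right multiplications, combined with uniform
  continuity of \<open>f\<close>.\<close>

lemma uc_pseudometric_orbit_dist: "uc_pseudometric (orbit_dist f)"
proof (rule uc_pseudometricI)
  fix e :: real assume "e > 0"
  define d where "d = e / 2"
  have "d > 0" "d < e" using \<open>e > 0\<close> by (auto simp: d_def)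
  have "\<forall>\<^sub>F z in uniformity. dist (apply_ubfun f (fst z)) (apply_ubfun f (snd z)) < d"
    using apply_ubfun_uniformly_continuous[of f] \<open>d > 0\<close>
    by (auto simp: uniformly_continuous_on_UNIV_metric case_prod_unfold)
  then have "\<forall>\<^sub>F (x, x') in uniformity.
      \<forall>g\<in>range (\<lambda>y x. x * y). dist (apply_ubfun f (g x)) (apply_ubfun f (g x')) < d"
    using uniformly_equicontinuous_mult_right[where 'a = 'a]
    unfolding uniformly_equicontinuous_def
    by (elim allE[of _ "\<lambda>z. dist (apply_ubfun f (fst z)) (apply_ubfun f (snd z)) < d"]) simp
  then show "\<forall>\<^sub>F (x, x') in uniformity. orbit_dist f x x' < e"
  proof eventually_elim
    case (elim z)
    obtain x x' where z: "z = (x, x')" by force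
    have "orbit_dist f x x' \<le> d"
      using elim unfolding orbit_dist_def
      by (intro norm_ubfun_le) (auto simp: z left_translate.rep_eq dist_real_def less_imp_le)
    then show ?case using \<open>d < e\<close> by (simp add: z)
  qed
next
  show "orbit_dist f x z \<le> orbit_dist f x y + orbit_dist f y z" for x y z
    unfolding orbit_dist_def by (metis dist_norm dist_triangle)
qed (auto simp: orbit_dist_def norm_minus_commute)

lemma conv_right_diff_le:
  "\<bar>apply_ubfun (conv_right \<nu> f) x - apply_ubfun (conv_right \<nu> f) x'\<bar> \<le> norm \<nu> * orbit_dist f x x'"
  using norm_blinfun[of \<nu> "left_translate x f - left_translate x' f"]
  by (simp add: conv_right_apply orbit_dist_def blinfun.diff_right)

text \<open>Continuity at \<open>0\<close> in terms of basic pointwise neighbourhoods.  By linearity it also controls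
  differences, since half the difference of two members of \<open>Lip \<Delta>\<close> is again in \<open>Lip \<Delta>\<close>.\<close>

lemma Lip_pointwise_small:
  fixes \<mu> :: "'a::uniform_space ub_dual"
  assumes \<mu>: "\<mu> \<in> uniform_measures" and \<Delta>: "uc_pseudometric \<Delta>" and "e > 0"
  shows "\<exists>F d. finite F \<and> d > 0 \<and>
    (\<forall>h\<in>Lip \<Delta>. (\<forall>z\<in>F. \<bar>h z\<bar> < d) \<longrightarrow> \<bar>blinfun_apply \<mu> (Ubfun h)\<bar> < e)"
proof -
  have cont: "continuous_on (Lip \<Delta>) (\<lambda>h. blinfun_apply \<mu> (Ubfun h))"
    using \<mu> \<Delta> by (auto simp: uniform_measures_def)
  obtain U where "open U"
    and U: "U \<inter> Lip \<Delta> = (\<lambda>h. blinfun_apply \<mu> (Ubfun h)) -` ball 0 e \<inter> Lip \<Delta>"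
    using cont[unfolded continuous_on_open_invariant, rule_format, OF open_ball[of 0 e]] by blast
  have zero: "(\<lambda>_. 0) \<in> Lip \<Delta>"
    using \<Delta> by (auto simp: Lip_def uc_pseudometric_def)
  have "Ubfun (\<lambda>_::'a. 0) = 0"
    using zero \<Delta> by (intro ubfun_eqI) simp
  then have "(\<lambda>_. 0) \<in> U"
    using U zero \<open>e > 0\<close> by (auto simp: set_eq_iff)
  moreover have "openin (product_topology (\<lambda>_::'a. euclideanreal) UNIV) U"
    using \<open>open U\<close> by (simp add: euclidean_product_topology)
  ultimately obtain X where X: "\<And>i. 0 \<in> X i" "\<And>i::'a. open (X i :: real set)"
      "finite {i. X i \<noteq> UNIV}" "(\<Pi>\<^sub>E i\<in>UNIV. X i) \<subseteq> U"
    using product_topology_open_contains_basis[of "\<lambda>_::'a. euclideanreal" UNIV U "\<lambda>_. 0"]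
    by (auto simp: PiE_iff)
  define F where "F = {i. X i \<noteq> UNIV}"
  have "\<exists>r>0. ball 0 r \<subseteq> X i" for i
    using X(1)[of i] X(2)[of i] by (simp add: open_contains_ball)
  then obtain r where r: "\<And>i. r i > 0" "\<And>i. ball 0 (r i) \<subseteq> X i"
    by metis
  define d where "d = Min (insert 1 (r ` F))"
  have "finite F" using X(3) by (simp add: F_def)
  then have "d > 0" and d: "\<And>i. i \<in> F \<Longrightarrow> d \<le> r i"
    using r(1) by (auto simp: d_def)
  have "\<bar>blinfun_apply \<mu> (Ubfun h)\<bar> < e" if "h \<in> Lip \<Delta>" "\<forall>z\<in>F. \<bar>h z\<bar> < d" for h
  proof -
    have "h i \<in> X i" for i
    proof (cases "i \<in> F")
      case True
      then have "h i \<in> ball 0 (r i)"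
        using that(2) d[of i] by force
      then show ?thesis using r(2) by blast
    qed (simp add: F_def)
    then have "h \<in> U" using X(4) by (auto simp: PiE_iff)
    then show ?thesis
      using that(1) U by auto
  qed
  then show ?thesis
    using \<open>finite F\<close> \<open>d > 0\<close> by blast
qed

text \<open>For \<open>norm \<nu> \<le> C\<close> the functions \<open>conv_right \<nu> f\<close> lie in a fixed multiple of \<open>Lip (orbit_dist f)\<close>, where
  \<open>\<mu>\<close> is pointwise continuous.\<close>

lemma conv_right_pointwise_small:
  fixes \<mu> :: "'a::semiuniform_semigroup ub_dual"
  assumes \<mu>: "\<mu> \<in> uniform_measures" and "e > 0"
  shows "\<exists>F d. finite F \<and> d > 0 \<and>
    (\<forall>\<nu>. norm \<nu> \<le> C \<longrightarrow> (\<forall>z\<in>F. \<bar>apply_ubfun (conv_right \<nu> f) z\<bar> < d) \<longrightarrow>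
      \<bar>blinfun_apply \<mu> (conv_right \<nu> f)\<bar> < e)"
proof -
  \<comment> \<open>Dominates both the sup norm bound \<open>C * norm f\<close> and the Lipschitz constant \<open>C\<close>.\<close>
  define c where "c = (\<bar>C\<bar> + 1) * (norm f + 1)"
  have "c > 0" by (simp add: c_def add_nonneg_pos)
  obtain F d where F: "finite F" "d > 0" and small:
    "\<And>h. h \<in> Lip (orbit_dist f) \<Longrightarrow> \<forall>z\<in>F. \<bar>h z\<bar> < d \<Longrightarrow> \<bar>blinfun_apply \<mu> (Ubfun h)\<bar> < e / c"
    using Lip_pointwise_small[OF \<mu> uc_pseudometric_orbit_dist[of f], of "e / c"] \<open>e > 0\<close> \<open>c > 0\<close>
    by auto
  have "\<bar>blinfun_apply \<mu> (conv_right \<nu> f)\<bar> < e"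
    if \<nu>: "norm \<nu> \<le> C" and z: "\<forall>z\<in>F. \<bar>apply_ubfun (conv_right \<nu> f) z\<bar> < c * d" for \<nu>
  proof -
    define h where "h = (1 / c) *\<^sub>R conv_right \<nu> f"
    have "norm \<nu> * norm f \<le> c" and "norm \<nu> \<le> c"
    proof -
      show "norm \<nu> * norm f \<le> c"
        unfolding c_def using \<nu> by (intro mult_mono) auto
      have "norm \<nu> * 1 \<le> c"
        unfolding c_def using \<nu> by (intro mult_mono) auto
      then show "norm \<nu> \<le> c" by simp
    qed
    have "apply_ubfun h \<in> Lip (orbit_dist f)"
    proof -
      have "\<bar>apply_ubfun h x\<bar> \<le> 1" for x
        using abs_apply_ubfun_le_norm[of "conv_right \<nu> f" x] norm_conv_right_le[of \<nu> f]
          \<open>norm \<nu> * norm f \<le> c\<close> \<open>c > 0\<close> by (simp add: h_def abs_mult)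
      moreover have "\<bar>apply_ubfun h x - apply_ubfun h x'\<bar> \<le> orbit_dist f x x'" for x x'
      proof -
        have "\<bar>apply_ubfun h x - apply_ubfun h x'\<bar>
            = \<bar>apply_ubfun (conv_right \<nu> f) x - apply_ubfun (conv_right \<nu> f) x'\<bar> / c"
          using \<open>c > 0\<close> by (simp add: h_def diff_divide_distrib[symmetric] abs_divide)
        also have "\<dots> \<le> norm \<nu> * orbit_dist f x x' / c"
          using \<open>c > 0\<close> by (intro divide_right_mono conv_right_diff_le) simp
        also have "\<dots> \<le> c * orbit_dist f x x' / c"
          using \<open>c > 0\<close> \<open>norm \<nu> \<le> c\<close>
          by (intro divide_right_mono mult_right_mono) (auto simp: orbit_dist_def)
        finally show ?thesis using \<open>c > 0\<close> by simp
      qed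
      ultimately show ?thesis
        by (auto simp: Lip_def abs_le_iff minus_le_iff)
    qed
    moreover have "\<forall>z\<in>F. \<bar>apply_ubfun h z\<bar> < d"
      using z \<open>c > 0\<close> by (simp add: h_def abs_mult field_simps)
    ultimately have "\<bar>blinfun_apply \<mu> h\<bar> < e / c"
      using small[of "apply_ubfun h"] by (simp add: apply_ubfun_inverse)
    then show ?thesis
      using \<open>c > 0\<close> by (simp add: h_def blinfun.scaleR_right abs_mult divide_less_cancel)
  qed
  then show ?thesis
    using F \<open>c > 0\<close> by (intro exI[of _ F] exI[of _ "c * d"]) auto
qed

text \<open>Nearby points \<open>x, x'\<close> give right translates of \<open>f\<close> that are close at each point, though in general not
  uniformly close, because left multiplications are uniformly continuous only one at a
  time.  Pointwise closeness suffices by the preceding lemma, applied to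
  \<open>point_mass x - point_mass x'\<close>.\<close>

lemma orbit_functional_ubfun:
  fixes \<mu> :: "'a::semiuniform_semigroup ub_dual"
  assumes \<mu>: "\<mu> \<in> uniform_measures"
  shows "\<exists>g. \<forall>x. apply_ubfun g x = blinfun_apply \<mu> (conv_right (point_mass x) f)"
proof -
  let ?g = "\<lambda>x. blinfun_apply \<mu> (conv_right (point_mass x) f)"
  have "\<bar>?g x\<bar> \<le> norm \<mu> * norm f" for x
  proof -
    have "norm (conv_right (point_mass x) f) \<le> norm f"
      using norm_conv_right_le[of "point_mass x" f]
        mult_right_mono[OF norm_point_mass_le[of x], of "norm f"] by simp
    then have "norm \<mu> * norm (conv_right (point_mass x) f) \<le> norm \<mu> * norm f"
      by (rule mult_left_mono) simp
    then show ?thesis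
      using norm_blinfun[of \<mu> "conv_right (point_mass x) f"] by simp
  qed
  then have "bounded (range ?g)"
    by (auto simp: bounded_iff)
  moreover have "uniformly_continuous_on UNIV ?g"
    unfolding uniformly_continuous_on_UNIV_metric
  proof (intro allI impI)
    fix e :: real assume "e > 0"
    obtain F d where F: "finite F" "d > 0" and small:
      "\<And>\<nu>. norm \<nu> \<le> 2 \<Longrightarrow> \<forall>z\<in>F. \<bar>apply_ubfun (conv_right \<nu> f) z\<bar> < d \<Longrightarrow>
        \<bar>blinfun_apply \<mu> (conv_right \<nu> f)\<bar> < e"
      using conv_right_pointwise_small[OF \<mu> \<open>e > 0\<close>, of 2 f] by blast
    have "\<forall>z\<in>F. \<forall>\<^sub>F (x, x') in uniformity. \<bar>apply_ubfun f (z * x) - apply_ubfun f (z * x')\<bar> < d"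
      using apply_ubfun_uniformly_continuous[of "left_translate _ f"] \<open>d > 0\<close>
      by (auto simp: uniformly_continuous_on_UNIV_metric left_translate.rep_eq dist_real_def)
    then have "\<forall>\<^sub>F u in uniformity. \<forall>z\<in>F.
        \<bar>apply_ubfun f (z * fst u) - apply_ubfun f (z * snd u)\<bar> < d"
      using F(1) by (intro eventually_ball_finite) (auto simp: case_prod_unfold)
    then show "\<forall>\<^sub>F (x, x') in uniformity. dist (?g x) (?g x') < e"
    proof eventually_elim
      case (elim u)
      obtain x x' where u: "u = (x, x')" by force
      define \<nu> where "\<nu> = point_mass x - point_mass x'"
      have "norm \<nu> \<le> 2"
        using norm_triangle_ineq4[of "point_mass x" "point_mass x'"]
          norm_point_mass_le[of x] norm_point_mass_le[of x'] by (simp add: \<nu>_def)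
      moreover have diff: "conv_right \<nu> f = conv_right (point_mass x) f - conv_right (point_mass x') f"
        unfolding \<nu>_def by (rule linear_diff[OF linear_conv_right])
      then have "\<forall>z\<in>F. \<bar>apply_ubfun (conv_right \<nu> f) z\<bar> < d"
        using elim by (simp add: u conv_right_point_mass)
      ultimately have "\<bar>blinfun_apply \<mu> (conv_right \<nu> f)\<bar> < e"
        by (rule small)
      then show ?case
        by (simp add: u diff blinfun.diff_right dist_real_def)
    qed
  qed
  ultimately show ?thesis
    using Ubfun_inverse[of ?g] by (intro exI[of _ "Ubfun ?g"]) simp
qed

text \<open>Both sides are linear in \<open>\<nu>\<close> and agree at point masses.  An arbitrary \<open>\<nu>\<close> is replaced by a combination
  \<open>\<sigma>\<close> of point masses such that \<open>\<nu> - \<sigma>\<close> is small both at \<open>g\<close> and at the finitely many left translates of \<open>f\<close>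
  that control \<open>\<mu>\<close> at \<open>conv_right (\<nu> - \<sigma>) f\<close>.\<close>

lemma convolution_uniform_measure:
  fixes \<mu> :: "'a::semiuniform_semigroup ub_dual"
  assumes \<mu>: "\<mu> \<in> uniform_measures"
  shows "\<exists>g. \<forall>\<nu>. blinfun_apply (\<mu> \<star> \<nu>) f = blinfun_apply \<nu> g"
proof -
  obtain g where g: "\<And>x. apply_ubfun g x = blinfun_apply \<mu> (conv_right (point_mass x) f)"
    using orbit_functional_ubfun[OF \<mu>] by blast
  have lin: "linear (\<lambda>\<nu>. blinfun_apply \<mu> (conv_right \<nu> f))"
    using linear_compose[OF linear_conv_right bounded_linear.linear[OF blinfun.bounded_linear_right]]
    by (simp add: comp_def)
  have span: "blinfun_apply \<sigma> g = blinfun_apply \<mu> (conv_right \<sigma> f)"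
    if "\<sigma> \<in> span (range point_mass)" for \<sigma>
    by (rule linear_eq_on_span[OF _ lin _ that])
      (auto simp: g intro: bounded_linear.linear[OF blinfun.bounded_linear_left])
  have "blinfun_apply \<mu> (conv_right \<nu> f) = blinfun_apply \<nu> g" for \<nu>
  proof (rule ccontr)
    assume "\<not> ?thesis"
    then have "\<bar>blinfun_apply \<nu> g - blinfun_apply \<mu> (conv_right \<nu> f)\<bar> / 2 > 0" (is "?e > 0")
      by simp
    obtain F d where F: "finite F" "d > 0" and small:
      "\<And>\<tau>. norm \<tau> \<le> 2 * norm \<nu> \<Longrightarrow> \<forall>z\<in>F. \<bar>apply_ubfun (conv_right \<tau> f) z\<bar> < d \<Longrightarrow>
        \<bar>blinfun_apply \<mu> (conv_right \<tau> f)\<bar> < ?e"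
      using conv_right_pointwise_small[OF \<mu> \<open>?e > 0\<close>, of "2 * norm \<nu>" f] by blast
    obtain \<sigma> where \<sigma>: "\<sigma> \<in> span (range point_mass)" "norm \<sigma> \<le> norm \<nu>"
      and close: "\<forall>h\<in>insert g ((\<lambda>z. left_translate z f) ` F). \<bar>blinfun_apply (\<nu> - \<sigma>) h\<bar> < min d ?e"
      using approximation_by_point_masses[of "insert g ((\<lambda>z. left_translate z f) ` F)" "min d ?e" \<nu>]
        F \<open>?e > 0\<close> by auto
    have "norm (\<nu> - \<sigma>) \<le> 2 * norm \<nu>"
      using norm_triangle_ineq4[of \<nu> \<sigma>] \<sigma>(2) by simp
    moreover have "\<forall>z\<in>F. \<bar>apply_ubfun (conv_right (\<nu> - \<sigma>) f) z\<bar> < d"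
      using close by (simp add: conv_right_apply)
    ultimately have "\<bar>blinfun_apply \<mu> (conv_right (\<nu> - \<sigma>) f)\<bar> < ?e"
      by (rule small)
    moreover have "blinfun_apply \<mu> (conv_right (\<nu> - \<sigma>) f)
        = blinfun_apply \<mu> (conv_right \<nu> f) - blinfun_apply \<sigma> g"
      using linear_diff[OF lin] span[OF \<sigma>(1)] by simp
    moreover have "\<bar>blinfun_apply \<nu> g - blinfun_apply \<sigma> g\<bar> < ?e"
      using close by (simp add: blinfun.diff_left)
    ultimately have "\<bar>blinfun_apply \<nu> g - blinfun_apply \<mu> (conv_right \<nu> f)\<bar> < ?e + ?e"
      by (smt (verit))
    then show False by simp
  qed
  then show ?thesis
    by (auto simp: convolution_conv_right)
qed

text \<open>Evaluation at a fixed function is weak* continuous by definition, so continuity holds on the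
  whole dual, not only on its norm-bounded subsets.\<close>

lemma uniform_measure_imp_continuous_convolution:
  fixes \<mu> :: "'a::semiuniform_semigroup ub_dual"
  assumes "\<mu> \<in> uniform_measures"
  shows "continuous_map weak_star weak_star ((\<star>) \<mu>)"
  unfolding continuous_on_strong_operator_topo_iff_coordinatewise
proof
  fix f :: "'a ubfun"
  obtain g where "\<And>\<nu>. blinfun_apply (\<mu> \<star> \<nu>) f = blinfun_apply \<nu> g"
    using convolution_uniform_measure[OF assms] by blast
  then show "continuous_map weak_star euclidean (\<lambda>\<nu>. blinfun_apply (\<mu> \<star> \<nu>) f)"
    by (simp add: strong_operator_topology_continuous_evaluation)
qed

section \<open>The topological centre\<close>

theorem theorem3p3:
  fixes S :: "'a::semiuniform_semigroup ub_dual set"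
  assumes "ambitable TYPE('a)"
    and "semigroup_on S (\<star>)"
    and "closure_of_points \<subseteq> S"
  shows "topological_center (subtopology weak_star S) (\<star>) = uniform_measures \<inter> S"
proof (intro equalityI subsetI)
  fix \<mu> assume "\<mu> \<in> topological_center (subtopology weak_star S) (\<star>)"
  then have "\<mu> \<in> S" and cont: "continuous_map (subtopology weak_star S) weak_star ((\<star>) \<mu>)"
    by (auto simp: topological_center_def intro: continuous_map_into_fulltopology)
  from continuous_map_from_subtopology_mono[OF cont assms(3)]
  have "\<mu> \<in> uniform_measures"
    by (rule continuous_convolution_imp_uniform_measure[OF assms(1)])
  with \<open>\<mu> \<in> S\<close> show "\<mu> \<in> uniform_measures \<inter> S" by blast
next
  fix \<mu> assume \<mu>: "\<mu> \<in> uniform_measures \<inter> S"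
  then have "continuous_map (subtopology weak_star S) weak_star ((\<star>) \<mu>)"
    by (intro continuous_map_from_subtopology uniform_measure_imp_continuous_convolution) simp
  moreover have "(\<star>) \<mu> \<in> S \<rightarrow> S"
    using \<mu> assms(2) by (auto simp: semigroup_on_def)
  ultimately show "\<mu> \<in> topological_center (subtopology weak_star S) (\<star>)"
    using \<mu> by (auto simp: topological_center_def continuous_map_in_subtopology
        strong_operator_topology_topspace)
qed

end
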